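(* Let $G$ be a simple undirected graph on $n$ vertices that is not regular. Then $\sigma_{t}(G)\geq n-1$ if $n$ is odd, and $\sigma_{t}(G)\geq 2n-4$ if $n$ is even.
   Context: For a finite simple graph $G$ with $d(v)$ the degree of $v$, $\sigma_{t}(G)=\sum_{\{u,v\}\subseteq V(G)}(d(u)-d(v))^{2}$, summing over all unordered pairs of distinct vertices. *)

theory Defs
  imports "Graph_Theory.Digraph"
begin

text \<open>
  A finite simple undirected graph is a \<^locale>\<open>graph\<close>: a finite, loop-free digraph without
  parallel arcs whose adjacency relation is symmetric. Each undirected edge is represented by two
  opposite arcs, so the degree of a vertex is its \<^const>\<open>out_degree\<close>, which counts every edge
  at the vertex exactly once.
\<close>

lemma (in graph) out_degree_eq_card_neighbours:
  "out_degree G v = card {w. v \<rightarrow>\<^bsub>G\<^esub> w}"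
proof -
  have "inj_on (head G) (out_arcs G v)"
    by (auto simp: inj_on_def arc_to_ends_def intro!: no_multi_arcs)
  moreover have "head G ` out_arcs G v = {w. v \<rightarrow>\<^bsub>G\<^esub> w}"
    by (auto simp: arcs_ends_conv image_iff)
  ultimately show ?thesis
    unfolding out_degree_def by (metis card_image)
qed

definition regular_graph :: "('a, 'b) pre_digraph \<Rightarrow> bool" where
  "regular_graph G \<longleftrightarrow> (\<exists>k. \<forall>v\<in>verts G. out_degree G v = k)"

text \<open>
  The summand of \<open>sigma_t\<close> as a function of the unordered pair; it is well defined because
  \<open>(d u - d v)\<^sup>2\<close> is symmetric in \<open>u\<close> and \<open>v\<close>. The degrees are
  subtracted as integers, since subtraction on \<^typ>\<open>nat\<close> truncates.
\<close>

definition sq_degree_diff :: "('a, 'b) pre_digraph \<Rightarrow> 'a set \<Rightarrow> int" where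
  "sq_degree_diff G e =
     (THE s. \<exists>u v. e = {u, v} \<and> s = (int (out_degree G u) - int (out_degree G v))\<^sup>2)"

lemma sq_degree_diff_pair [simp]:
  "sq_degree_diff G {u, v} = (int (out_degree G u) - int (out_degree G v))\<^sup>2"
  unfolding sq_degree_diff_def
  by (rule the_equality) (auto simp: doubleton_eq_iff power2_commute)

definition sigma_t :: "('a, 'b) pre_digraph \<Rightarrow> int" where
  "sigma_t G = (\<Sum>e | e \<subseteq> verts G \<and> card e = 2. sq_degree_diff G e)"

end

theory Submission
  imports Defs
begin

text \<open>
  If a set \<open>A\<close> of vertices is a union of degree classes, each of the \<open>|A| (n - |A|)\<close> pairs
  separated by \<open>A\<close> contributes at least \<open>1\<close>. A degree class of a non-regular graph gives \<open>n - 1\<close>,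
  and any such \<open>A\<close> with \<open>2 \<le> |A| \<le> n - 2\<close> gives \<open>2 n - 4\<close>. If \<open>n \<ge> 4\<close> and there is no such \<open>A\<close>,
  all vertices but one have the same degree \<open>k\<close>, the last one having degree \<open>l \<noteq> k\<close>. For even \<open>n\<close>
  the handshake lemma makes \<open>(n - 1) k + l\<close> even, so \<open>k\<close> and \<open>l\<close> differ by at least \<open>2\<close> and
  \<open>\<sigma>\<^sub>t \<ge> 4 (n - 1)\<close>.
\<close>

text \<open>Swapping components maps \<open>R\<close> to itself by symmetry and has no fixed point
  by irreflexivity, so \<open>R\<close> splits into orbits of size 2.\<close>

lemma even_card_sym_irrefl:
  assumes "finite R" "sym R" "irrefl R"
  shows "even (card R)"
proof -
  let ?C = "(\<lambda>e. {e, prod.swap e}) ` R"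
  have U: "\<Union> ?C = R"
    using \<open>sym R\<close> by (auto simp: sym_def)
  have "2 dvd card (\<Union> ?C)"
  proof (rule dvd_partition)
    show "finite (\<Union> ?C)"
      using U \<open>finite R\<close> by simp
    have "e \<noteq> prod.swap e" if "e \<in> R" for e
      using that \<open>irrefl R\<close> by (cases e) (auto simp: irrefl_def)
    then show "\<forall>c\<in>?C. 2 dvd card c"
      by simp
    \<comment> \<open>An orbit is recovered from any of its elements, so distinct orbits are
      disjoint.\<close>
    have eq: "c = {x, prod.swap x}" if "c \<in> ?C" "x \<in> c" for c x
      using that by (auto simp: insert_commute)
    show "\<forall>c1\<in>?C. \<forall>c2\<in>?C. c1 \<noteq> c2 \<longrightarrow> c1 \<inter> c2 = {}"
    proof (intro ballI impI)
      fix c1 c2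
      assume c: "c1 \<in> ?C" "c2 \<in> ?C" "c1 \<noteq> c2"
      have False if "x \<in> c1" "x \<in> c2" for x
        using eq[OF c(1) that(1)] eq[OF c(2) that(2)] c(3) by simp
      then show "c1 \<inter> c2 = {}"
        by auto
    qed
  qed
  then show ?thesis
    using U by simp
qed

text \<open>Handshake lemma: the degree sum counts the ordered pairs of adjacent vertices, a
  symmetric irreflexive relation.\<close>

lemma (in graph) even_sum_out_degree: "even (\<Sum>v\<in>verts G. out_degree G v)"
proof -
  have fin: "finite {w. v \<rightarrow>\<^bsub>G\<^esub> w}" for v
    by (rule finite_subset[OF _ finite_verts]) (auto dest: adj_in_verts)
  have "(\<Sum>v\<in>verts G. out_degree G v) = card (SIGMA v:verts G. {w. v \<rightarrow>\<^bsub>G\<^esub> w})"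
    using fin by (simp add: out_degree_eq_card_neighbours)
  also have "(SIGMA v:verts G. {w. v \<rightarrow>\<^bsub>G\<^esub> w}) = arcs_ends G"
    by (auto dest: adj_in_verts)
  also have "even (card (arcs_ends G))"
  proof (rule even_card_sym_irrefl)
    show "finite (arcs_ends G)"
      by (simp add: arcs_ends_def)
    show "sym (arcs_ends G)"
      using sym_arcs by (simp add: symmetric_def)
    show "irrefl (arcs_ends G)"
      by (auto simp: irrefl_def dest: adj_not_same)
  qed
  finally show ?thesis .
qed

text \<open>Each pair crossing the cut has one end in \<open>A\<close>, so distinct elements of the
  product give distinct summands; all other summands are squares. The cases needed are
  \<open>m = 1\<close> for degree classes and \<open>m = 4\<close> for one exceptional
  vertex.\<close>

lemma (in fin_digraph) sigma_t_ge_cut: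
  assumes "A \<subseteq> verts G"
    and "\<And>u v. u \<in> A \<Longrightarrow> v \<in> verts G - A \<Longrightarrow>
           m \<le> (int (out_degree G u) - int (out_degree G v))\<^sup>2"
  shows "m * (int (card A) * int (card (verts G) - card A)) \<le> sigma_t G"
proof -
  let ?P = "A \<times> (verts G - A)" and ?f = "\<lambda>(u, v). {u, v}"
  have inj: "inj_on ?f ?P"
    by (auto simp: inj_on_def doubleton_eq_iff)
  have "card (verts G - A) = card (verts G) - card A"
    using assms(1) by (simp add: card_Diff_subset finite_subset)
  then have "m * (int (card A) * int (card (verts G) - card A)) = (\<Sum>p\<in>?P. m)"
    by (simp add: card_cartesian_product)
  also have "\<dots> \<le> (\<Sum>p\<in>?P. sq_degree_diff G (?f p))"
    by (rule sum_mono) (use assms(2) in auto)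
  also have "\<dots> = (\<Sum>e\<in>?f ` ?P. sq_degree_diff G e)"
    by (simp add: sum.reindex[OF inj])
  also have "\<dots> \<le> sigma_t G"
    unfolding sigma_t_def
  proof (rule sum_mono2)
    show "finite {e. e \<subseteq> verts G \<and> card e = 2}"
      by simp
    show "?f ` ?P \<subseteq> {e. e \<subseteq> verts G \<and> card e = 2}"
      using assms(1) by (auto simp: card_insert_if)
    show "0 \<le> sq_degree_diff G e" if "e \<in> {e. e \<subseteq> verts G \<and> card e = 2} - ?f ` ?P" for e
      using that by (auto simp: card_2_iff)
  qed
  finally show ?thesis .
qed

lemma one_le_int_diff_sq:
  fixes a b :: int
  assumes "a \<noteq> b"
  shows "1 \<le> (a - b)\<^sup>2"
  using assms by (simp add: int_one_le_iff_zero_less)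

lemma (in fin_digraph) sigma_t_ge_union_degree_classes:
  "int (card {v \<in> verts G. out_degree G v \<in> D})
      * int (card (verts G) - card {v \<in> verts G. out_degree G v \<in> D}) \<le> sigma_t G"
proof -
  let ?A = "{v \<in> verts G. out_degree G v \<in> D}"
  have "1 * (int (card ?A) * int (card (verts G) - card ?A)) \<le> sigma_t G"
  proof (rule sigma_t_ge_cut)
    show "1 \<le> (int (out_degree G u) - int (out_degree G v))\<^sup>2"
      if "u \<in> ?A" "v \<in> verts G - ?A" for u v
      by (rule one_le_int_diff_sq) (use that in auto)
  qed auto
  then show ?thesis
    by simp
qed

text \<open>The difference of the two sides factors as \<open>(a - c) * (n - a - c)\<close>.\<close>

lemma mult_diff_ge:
  fixes a c n :: nat
  assumes "c \<le> a" "a + c \<le> n"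
  shows "int c * (int n - int c) \<le> int a * int (n - a)"
proof -
  have "0 \<le> (int a - int c) * (int n - int a - int c)"
    using assms by (intro mult_nonneg_nonneg) auto
  then show ?thesis
    using assms by (simp add: algebra_simps of_nat_diff)
qed

lemma (in graph) sigma_t_ge_one_exceptional_degree:
  assumes "even (card (verts G))" "w \<in> verts G"
    and k: "\<And>v. v \<in> verts G - {w} \<Longrightarrow> out_degree G v = k" and "out_degree G w \<noteq> k"
  shows "4 * (int (card (verts G)) - 1) \<le> sigma_t G"
proof -
  have pos: "0 < card (verts G)"
    using assms(2) by (auto simp: card_gt_0_iff)
  have "(\<Sum>v\<in>verts G. out_degree G v) = out_degree G w + (card (verts G) - 1) * k"
    using assms(2) k by (simp add: sum.remove)
  then have "even (out_degree G w + (card (verts G) - 1) * k)"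
    using even_sum_out_degree by simp
  \<comment> \<open>\<open>card (verts G) - 1\<close> is odd, so its product with \<open>k\<close>
    has the parity of \<open>k\<close>.\<close>
  then have "even (int (out_degree G w) - int k)"
    using assms(1) pos by auto
  then obtain j where j: "int (out_degree G w) - int k = 2 * j"
    by blast
  with assms(4) have "1 \<le> (j - 0)\<^sup>2"
    by (intro one_le_int_diff_sq) auto
  then have "4 \<le> (int (out_degree G w) - int k)\<^sup>2"
    unfolding j by (simp add: power2_eq_square)
  then have "4 * (int (card {w}) * int (card (verts G) - card {w})) \<le> sigma_t G"
    using assms(2) k by (intro sigma_t_ge_cut) auto
  then show ?thesis
    using pos by (simp add: of_nat_diff)
qed

lemma (in graph) sigma_t_bounds:
  assumes "\<not> regular_graph G"
  shows "int (card (verts G)) - 1 \<le> sigma_t G"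
    and "even (card (verts G)) \<Longrightarrow> 2 * int (card (verts G)) - 4 \<le> sigma_t G"
proof -
  let ?n = "card (verts G)"
  \<comment> \<open>\<open>D\<close> is a set of degrees, so that single classes and the union of
    two classes are treated alike.\<close>
  define U where "U D = {v \<in> verts G. out_degree G v \<in> D}" for D
  have finU: "finite (U D)" for D
    by (simp add: U_def)
  have cut: "int (card (U D)) * int (?n - card (U D)) \<le> sigma_t G" for D
    using sigma_t_ge_union_degree_classes[of D] by (simp add: U_def)
  have subV: "U D \<subseteq> verts G" for D
    by (auto simp: U_def)
  obtain u w where uw: "u \<in> verts G" "w \<in> verts G" "out_degree G u \<noteq> out_degree G w"
    using assms unfolding regular_graph_def by metis
  let ?A = "U {out_degree G u}" and ?B = "U {out_degree G w}"
  have un: "U {out_degree G u, out_degree G w} = ?A \<union> ?B" and dis: "?A \<inter> ?B = {}"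
    using uw(3) by (auto simp: U_def)
  have pos: "1 \<le> card ?A" "1 \<le> card ?B"
    using uw finU by (auto simp: U_def Suc_le_eq card_gt_0_iff)
  have card_un: "card (?A \<union> ?B) = card ?A + card ?B"
    using dis finU by (simp add: card_Un_disjoint)
  have le_n: "card ?A + card ?B \<le> ?n"
    using card_mono[OF finite_verts, of "?A \<union> ?B"] subV card_un by auto
  \<comment> \<open>\<open>?A\<close> misses the nonempty class \<open>?B\<close>, so its size lies
    between 1 and \<open>?n - 1\<close>.\<close>
  show bound: "int ?n - 1 \<le> sigma_t G"
    using mult_diff_ge[of 1 "card ?A" ?n] cut[of "{out_degree G u}"] pos le_n by simp
  show "2 * int ?n - 4 \<le> sigma_t G" if "even ?n"
  proof (cases "\<exists>D. 2 \<le> card (U D) \<and> card (U D) + 2 \<le> ?n")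
    case True
    then obtain D where "2 \<le> card (U D)" "card (U D) + 2 \<le> ?n"
      by blast
    then show ?thesis
      using mult_diff_ge[of 2 "card (U D)" ?n] cut[of D] by simp
  next
    case False
    then have no: "card (U D) < 2 \<or> ?n < card (U D) + 2" for D
      by (meson not_le)
    have exceptional: "4 * (int ?n - 1) \<le> sigma_t G"
      if "x \<in> verts G" "y \<in> verts G" "out_degree G x \<noteq> out_degree G y"
        "?n \<le> card (U {out_degree G x}) + 1" for x y
    proof -
      have "card (verts G - U {out_degree G x}) \<le> 1"
        using that(4) subV finU by (simp add: card_Diff_subset)
      moreover have "y \<in> verts G - U {out_degree G x}"
        using that by (auto simp: U_def)
      ultimately have "verts G - U {out_degree G x} = {y}"
        by (metis (no_types, lifting) card_le_Suc0_iff_eq One_nat_def finite_Diff finite_verts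
            is_singletonI' is_singleton_the_elem empty_iff singletonD)
      then have "v \<in> verts G - {y} \<Longrightarrow> out_degree G v = out_degree G x" for v
        by (auto simp: U_def)
      then show ?thesis
        using sigma_t_ge_one_exceptional_degree[of y "out_degree G x"] that \<open>even ?n\<close>
        by simp
    qed
    have "card ?A + card ?B < 2 \<or> ?n < card ?A + card ?B + 2"
      using no[of "{out_degree G u, out_degree G w}"] un card_un by simp
    \<comment> \<open>If each class omits at least two vertices, \<open>no\<close> makes both
      singletons. Their union has size 2, which forces \<open>?n < 4\<close>, and evenness leaves
      \<open>?n = 2\<close>.\<close>
    then have "?n = 2 \<or> ?n \<le> card ?A + 1 \<or> ?n \<le> card ?B + 1"
      using pos le_n \<open>even ?n\<close> no[of "{out_degree G u}"] no[of "{out_degree G w}"] by presburger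
    then consider "?n = 2" | "4 * (int ?n - 1) \<le> sigma_t G"
      using exceptional[OF uw] exceptional[OF uw(2,1)] uw(3) by metis
    then show ?thesis
    proof cases
      case 1
      \<comment> \<open>For two vertices the general bound is 1, while only 0 is required.\<close>
      then show ?thesis
        using bound by simp
    next
      case 2
      then show ?thesis
        by simp
    qed
  qed
qed

theorem theorem17:
  fixes G :: "('a, 'b) pre_digraph" and n :: nat
  assumes "graph G"
    and "card (verts G) = n"
    and "\<not> regular_graph G"
  shows "(odd n \<longrightarrow> sigma_t G \<ge> int n - 1) \<and>
         (even n \<longrightarrow> sigma_t G \<ge> 2 * int n - 4)"
  using graph.sigma_t_bounds[OF assms(1,3)] assms(2) by blast

end
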